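(* Let $G=(V,E)$ be a weighted digraph without loops whose $n$ vertices are indexed by integers, let $r$ be a vertex of $G$ selected as the root, let $k\ge 0$, and let $t'$ be a tree in $G$, rooted at $r$, of length $k+1$. Let $T(k+1,r)$ be the set of $r$-rooted projective pre-spanning trees of generation $k+1$ of $G$, let $G(t')$ be the digraph with distinguished new vertex $v^*$ constructed from $G$ and $t'$, and let $A(t')^{in}$ be the in-degree matrix of $G(t')$ (all defined in the context). Then the tree $t'$ belongs to $T(k+1,r)$ (i.e. is a part of some spanning tree of $G$) if and only if the determinant of the matrix obtained from $A(t')^{in}$ by removing the row and the column of $v^*$ is not zero.
   Context: Rooted trees are directed, with arcs going away from the root $r$; the length of a tree is the largest distance from $r$ to its vertices. An arc connecting two vertices is associated with the pair $\{\underline{m},\overline{m}\}$, $\underline{m}<\overline{m}$, of their indexes; two arcs $\{\underline{m},\overline{m}\}$ and $\{\underline{l},\overline{l}\}$ are in conflict if the intervals $[\underline{m},\overline{m}]$ and $[\underline{l},\overline{l}]$ have a non-empty intersection different from each of the two intervals. A subgraph is projective if no two of its arcs are in conflict. The sets $T(k,r)$ are defined by induction. $T(0,r)$ consists of the root $r$ if $G$ has at least one $r$-rooted spanning tree. $T(k+1,r)$ consists of all the $r$-rooted projective trees $t'$ in $G$ such that: 1) the length of $t'$ is $k+1$; 2) $t'$ can be obtained from some $t\in T(k,r)$ by adding new arcs going from leaves of $t$ whose distance to $r$ is $k$, these arcs having no conflicts either between each other or with the arcs of $t$; 3) $t'$ can be extended to a spanning tree of $G$ by connecting its leaves whose distance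 to $r$ is $k+1$ with the roots of a forest of the subgraph $G\setminus t'$. Here $G\setminus t'$ is the subgraph of $G$ induced by $V(G)\setminus V(t')$. The digraph $G(t')$ has vertex set $(V(G)\setminus V(t'))\cup\{v^*\}$, where $v^*$ is a new vertex, and arc set $E(G\setminus t')\cup\{(v^*,z): z\in Z_k\}$, where $Z_k$ is the set of vertices $z$ of $G\setminus t'$ for which there is $d\in V(t')$ with $dist(r,d)=k+1$ and $(d,z)\in E(G)$. Let $A(t')$ be the adjacency matrix of $G(t')$, with the convention that the number $\deg(t')^{in}_i$ of arcs entering the vertex $i$ equals the number of entries equal to $1$ in the $i$-th row of $A(t')$. The in-degree matrix is $A(t')^{in}=-A(t')+\Lambda(t')^{in}$, where $\Lambda(t')^{in}_{ij}=\tfrac12\deg(t')^{in}_i\,\delta_{ij}$ and $\delta_{ij}$ is the Kronecker delta.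
   Formalization: The diagonal of the in-degree matrix is taken to be the full in-degree instead of 1/2 of it, and the tree t' is assumed projective; without either correction the stated equivalence is false. *)

theory Defs
  imports "Graph_Theory.Graph_Theory" "Jordan_Normal_Form.Determinant" "HOL-Library.FuncSet"
begin

text \<open>
  Finite digraphs without loops and without parallel arcs, with real arc weights \<open>w\<close> and with
  vertices indexed by pairwise distinct integers \<open>ix\<close>.  Since \<open>w\<close> is a function on the arc set,
  it is required to be extensional; no condition is put on the weights themselves, and nothing
  below depends on them.
\<close>
locale indexed_weighted_digraph = pair_digraph G
  for G :: "'a pair_pre_digraph" +
  fixes w :: "('a \<times> 'a) weight_fun" and ix :: "'a \<Rightarrow> int"
  assumes weight: "w \<in> parcs G \<rightarrow>\<^sub>E UNIV"
    and index: "inj_on ix (pverts G)"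

subsection \<open>Rooted trees and forests\<close>

text \<open>
  The predicates \<^const>\<open>tree\<close> and \<^const>\<open>forest\<close> of the library are meant for symmetric digraphs.
  Here arcs point away from the root.
\<close>
definition rooted_tree :: "'a \<Rightarrow> 'a pair_pre_digraph \<Rightarrow> bool" where
  "rooted_tree r t \<longleftrightarrow> pair_fin_digraph t \<and> r \<in> pverts t
     \<and> (\<forall>v\<in>pverts t. \<exists>!p. pre_digraph.awalk t r p v)"

text \<open>A disjoint union of rooted trees, \<open>R\<close> being the set of their roots; it may be empty.\<close>
definition rooted_forest :: "'a set \<Rightarrow> 'a pair_pre_digraph \<Rightarrow> bool" where
  "rooted_forest R F \<longleftrightarrow> pair_fin_digraph F \<and> R \<subseteq> pverts F
     \<and> (\<forall>v\<in>pverts F. \<exists>!(u, p). u \<in> R \<and> pre_digraph.awalk F u p v)"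

definition rooted_spanning_tree :: "'a pair_pre_digraph \<Rightarrow> 'a \<Rightarrow> 'a pair_pre_digraph \<Rightarrow> bool" where
  "rooted_spanning_tree G r s \<longleftrightarrow> spanning (with_proj s) (with_proj G) \<and> rooted_tree r s"

definition dist_in :: "'a pair_pre_digraph \<Rightarrow> 'a \<Rightarrow> 'a \<Rightarrow> ereal" where
  "dist_in t u v = wf_digraph.\<mu> t (\<lambda>_. 1) u v"

definition tree_length :: "'a \<Rightarrow> 'a pair_pre_digraph \<Rightarrow> ereal" where
  "tree_length r t = Max (dist_in t r ` pverts t)"

definition leaves_at :: "'a \<Rightarrow> 'a pair_pre_digraph \<Rightarrow> nat \<Rightarrow> 'a set" where
  "leaves_at r t k = {d \<in> pverts t. out_arcs t d = {} \<and> dist_in t r d = ereal (real k)}"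

subsection \<open>Projectivity\<close>

definition arc_interval :: "('a \<Rightarrow> int) \<Rightarrow> 'a \<times> 'a \<Rightarrow> int set" where
  "arc_interval ix e =
     {min (ix (fst e)) (ix (snd e)) .. max (ix (fst e)) (ix (snd e))}"

text \<open>
  The intervals are closed, so that two arcs with intervals \<open>[a, b]\<close> and \<open>[b, c]\<close>,
  \<open>a < b < c\<close>, are in conflict.  As the end points are integers, integer and real intervals give
  the same relation.
\<close>
definition in_conflict :: "('a \<Rightarrow> int) \<Rightarrow> 'a \<times> 'a \<Rightarrow> 'a \<times> 'a \<Rightarrow> bool" where
  "in_conflict ix e f \<longleftrightarrow> arc_interval ix e \<inter> arc_interval ix f \<noteq> {}
     \<and> arc_interval ix e \<inter> arc_interval ix f \<noteq> arc_interval ix e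
     \<and> arc_interval ix e \<inter> arc_interval ix f \<noteq> arc_interval ix f"

definition projective :: "('a \<Rightarrow> int) \<Rightarrow> 'a pair_pre_digraph \<Rightarrow> bool" where
  "projective ix t \<longleftrightarrow> (\<forall>e\<in>parcs t. \<forall>f\<in>parcs t. \<not> in_conflict ix e f)"

subsection \<open>Pre-spanning trees\<close>

definition delete_verts_of ::
  "'a pair_pre_digraph \<Rightarrow> 'a pair_pre_digraph \<Rightarrow> 'a pair_pre_digraph" where
  "delete_verts_of G t = \<lparr> pverts = pverts G - pverts t,
     parcs = {(u, v) \<in> parcs G. u \<notin> pverts t \<and> v \<notin> pverts t} \<rparr>"

definition grown_from ::
  "'a pair_pre_digraph \<Rightarrow> ('a \<Rightarrow> int) \<Rightarrow> 'a \<Rightarrow> nat \<Rightarrow> 'a pair_pre_digraph \<Rightarrow> 'a pair_pre_digraph \<Rightarrow> bool"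
  where
  "grown_from G ix r k t t' \<longleftrightarrow> (\<exists>N. N \<subseteq> parcs G - parcs t
     \<and> fst ` N \<subseteq> leaves_at r t k
     \<and> (\<forall>e\<in>N. \<forall>f\<in>N \<union> parcs t. \<not> in_conflict ix e f)
     \<and> pverts t' = pverts t \<union> snd ` N \<and> parcs t' = parcs t \<union> N)"

definition extends_to_spanning_tree ::
  "'a pair_pre_digraph \<Rightarrow> 'a \<Rightarrow> nat \<Rightarrow> 'a pair_pre_digraph \<Rightarrow> bool" where
  "extends_to_spanning_tree G r k t' \<longleftrightarrow> (\<exists>F R C.
     subgraph (with_proj F) (with_proj (delete_verts_of G t')) \<and> rooted_forest R F
     \<and> C \<subseteq> parcs G \<inter> (leaves_at r t' k \<times> R)
     \<and> rooted_spanning_tree G r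
         \<lparr> pverts = pverts t' \<union> pverts F, parcs = parcs t' \<union> C \<union> parcs F \<rparr>)"

text \<open>The sets \<open>T(k, r)\<close>.\<close>
primrec pre_spanning_trees ::
  "'a pair_pre_digraph \<Rightarrow> ('a \<Rightarrow> int) \<Rightarrow> 'a \<Rightarrow> nat \<Rightarrow> 'a pair_pre_digraph set" where
  "pre_spanning_trees G ix r 0 =
     (if \<exists>s. rooted_spanning_tree G r s then {\<lparr> pverts = {r}, parcs = {} \<rparr>} else {})"
| "pre_spanning_trees G ix r (Suc k) =
     {t'. subgraph (with_proj t') (with_proj G) \<and> rooted_tree r t' \<and> projective ix t'
        \<and> tree_length r t' = ereal (real (k + 1))
        \<and> (\<exists>t\<in>pre_spanning_trees G ix r k. grown_from G ix r k t t')
        \<and> extends_to_spanning_tree G r (k + 1) t'}"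

subsection \<open>The digraph \<open>G(t')\<close> and its in-degree matrix\<close>

text \<open>
  The old vertices are \<open>Some z\<close>, the new vertex \<open>v\<^sup>*\<close> is \<open>None\<close>.  The parameter \<open>k\<close> is the one
  for which \<open>t'\<close> has length \<open>k + 1\<close>; the distance of \<open>r\<close> and \<open>d\<close> is measured in \<open>t'\<close>.
\<close>
definition attach_verts :: "'a pair_pre_digraph \<Rightarrow> 'a \<Rightarrow> nat \<Rightarrow> 'a pair_pre_digraph \<Rightarrow> 'a set" where
  "attach_verts G r k t' = {z \<in> pverts (delete_verts_of G t').
     \<exists>d\<in>pverts t'. dist_in t' r d = ereal (real (k + 1)) \<and> (d, z) \<in> parcs G}"

definition contracted_digraph ::
  "'a pair_pre_digraph \<Rightarrow> 'a \<Rightarrow> nat \<Rightarrow> 'a pair_pre_digraph \<Rightarrow> 'a option pair_pre_digraph" where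
  "contracted_digraph G r k t' =
     \<lparr> pverts = insert None (Some ` pverts (delete_verts_of G t')),
       parcs = map_prod Some Some ` parcs (delete_verts_of G t')
         \<union> {(None, Some z) | z. z \<in> attach_verts G r k t'} \<rparr>"

text \<open>
  Matrices are taken with respect to an enumeration \<open>vs\<close> of the vertices.  The ones in row \<open>i\<close>
  stand for the arcs entering the \<open>i\<close>-th vertex.
\<close>
definition adjacency_matrix :: "'b pair_pre_digraph \<Rightarrow> 'b list \<Rightarrow> real mat" where
  "adjacency_matrix H vs = mat (length vs) (length vs)
     (\<lambda>(i, j). if (vs ! j, vs ! i) \<in> parcs H then 1 else 0)"

text \<open>
  The diagonal entries are the full in-degrees, as in Tutte's matrix-tree theorem.  The source
  prints \<open>1/2\<close> times the in-degrees, which makes the theorem false: for the vertices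
  \<open>r, d, x, y\<close> with arcs \<open>(r,d), (d,x), (d,y), (x,y), (y,x)\<close> and for \<open>t'\<close> the tree with the
  single arc \<open>(r,d)\<close>, halving turns the reduced matrix into the singular matrix with rows
  \<open>(1, -1)\<close> and \<open>(-1, 1)\<close>, although \<open>t'\<close> is contained in a spanning tree.
\<close>
definition in_degree_diagonal :: "'b pair_pre_digraph \<Rightarrow> 'b list \<Rightarrow> real mat" where
  "in_degree_diagonal H vs = mat (length vs) (length vs)
     (\<lambda>(i, j). if i = j then real (in_degree H (vs ! i)) else 0)"

definition in_degree_matrix :: "'b pair_pre_digraph \<Rightarrow> 'b list \<Rightarrow> real mat" where
  "in_degree_matrix H vs = - adjacency_matrix H vs + in_degree_diagonal H vs"

end

theory Submission
  imports Defs
begin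

text \<open>
  Both conditions say that every vertex of \<open>G(t')\<close> is reachable from \<open>v\<^sup>*\<close>; the matrix-tree
  theorem itself is not needed.

  For the matrix: if all vertices are reachable, a null vector has constant modulus on the
  ancestors of a vertex where that modulus is maximal, because each entry is the average of the
  entries of the in-neighbours, \<open>v\<^sup>*\<close> counting as \<open>0\<close>; going back to \<open>v\<^sup>*\<close>, the modulus is \<open>0\<close>.
  If the set \<open>U\<close> of unreachable vertices is non-empty, the rows of \<open>U\<close> are supported in \<open>U\<close> and
  sum to zero, so the matrix is singular.

  For the trees: a breadth-first forest extends \<open>t'\<close> to a spanning tree \<open>s\<close> in which the new
  vertices are deeper than \<open>k + 1\<close>. Then \<open>t'\<close> is the truncation of \<open>s\<close> at depth \<open>k + 1\<close>, and the
  truncations of \<open>s\<close> at smaller depths witness its membership in \<open>T(k + 1, r)\<close>.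
\<close>

subsection \<open>Singular matrices indexed by a finite set\<close>

text \<open>Null vectors become functions on the index set \<open>S\<close> itself. This removes the
  enumeration \<open>u\<close>, so that later arguments speak of vertices rather than matrix
  positions.\<close>

lemma det_reindexed_eq_0_iff:
  fixes f :: "'b \<Rightarrow> 'b \<Rightarrow> 'c :: idom"
  assumes u: "bij_betw u {..<m} S"
  shows "det (mat m m (\<lambda>(i, j). f (u i) (u j))) = 0
    \<longleftrightarrow> (\<exists>x. (\<exists>i\<in>S. x i \<noteq> 0) \<and> (\<forall>i\<in>S. (\<Sum>j\<in>S. f i j * x j) = 0))"
    (is "det ?A = 0 \<longleftrightarrow> ?R")
proof -
  have A: "?A \<in> carrier_mat m m" by simp
  have S: "S = u ` {..<m}" using u by (simp add: bij_betw_def)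
  have row: "(?A *\<^sub>v vec m (\<lambda>i. x (u i))) $ i = (\<Sum>j\<in>S. f (u i) j * x j)" if "i < m" for x i
  proof -
    have "(?A *\<^sub>v vec m (\<lambda>i. x (u i))) $ i = (\<Sum>j<m. f (u i) (u j) * x (u j))"
      using that by (simp add: scalar_prod_def atLeast0LessThan)
    also have "\<dots> = (\<Sum>j\<in>S. f (u i) j * x j)"
      by (rule sum.reindex_bij_betw[OF u])
    finally show ?thesis .
  qed
  have null: "vec m (\<lambda>i. x (u i)) \<noteq> 0\<^sub>v m \<and> ?A *\<^sub>v vec m (\<lambda>i. x (u i)) = 0\<^sub>v m
    \<longleftrightarrow> (\<exists>i\<in>S. x i \<noteq> 0) \<and> (\<forall>i\<in>S. (\<Sum>j\<in>S. f i j * x j) = 0)" for x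
  proof -
    have "?A *\<^sub>v vec m (\<lambda>i. x (u i)) = 0\<^sub>v m \<longleftrightarrow> (\<forall>i\<in>S. (\<Sum>j\<in>S. f i j * x j) = 0)"
      using row[of _ x] unfolding S by (subst vec_eq_iff) auto
    moreover have "vec m (\<lambda>i. x (u i)) \<noteq> 0\<^sub>v m \<longleftrightarrow> (\<exists>i\<in>S. x i \<noteq> 0)"
      unfolding S by (subst vec_eq_iff) auto
    ultimately show ?thesis by blast
  qed
  \<comment> \<open>Every vector of dimension \<open>m\<close> comes from a function on
    \<open>S\<close>, read off through the inverse of \<open>u\<close>.\<close>
  have cover: "\<exists>x. v = vec m (\<lambda>i. x (u i))" if "v \<in> carrier_vec m" for v :: "'c vec"
  proof
    show "v = vec m (\<lambda>i. v $ inv_into {..<m} u (u i))"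
      using that u by (auto simp: vec_eq_iff bij_betw_def)
  qed
  show ?thesis
    unfolding det_0_iff_vec_prod_zero[OF A]
  proof
    assume "\<exists>v. v \<in> carrier_vec m \<and> v \<noteq> 0\<^sub>v m \<and> ?A *\<^sub>v v = 0\<^sub>v m"
    then obtain v where v: "v \<in> carrier_vec m" "v \<noteq> 0\<^sub>v m" "?A *\<^sub>v v = 0\<^sub>v m" by blast
    obtain x where "v = vec m (\<lambda>i. x (u i))" using cover[OF v(1)] by blast
    with v null[of x] show ?R by blast
  next
    assume ?R
    then obtain x where "(\<exists>i\<in>S. x i \<noteq> 0) \<and> (\<forall>i\<in>S. (\<Sum>j\<in>S. f i j * x j) = 0)" by blast
    then show "\<exists>v. v \<in> carrier_vec m \<and> v \<noteq> 0\<^sub>v m \<and> ?A *\<^sub>v v = 0\<^sub>v m"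
      using null[of x] vec_carrier[of m "\<lambda>i. x (u i)"] by blast
  qed
qed

text \<open>Transposing keeps the determinant and turns null vectors into left null vectors. Both
  kinds are needed to transfer singularity between matrices sharing some rows.\<close>

lemma det_reindexed_eq_0_iff_left:
  fixes f :: "'b \<Rightarrow> 'b \<Rightarrow> 'c :: idom"
  assumes u: "bij_betw u {..<m} S"
  shows "det (mat m m (\<lambda>(i, j). f (u i) (u j))) = 0
    \<longleftrightarrow> (\<exists>x. (\<exists>i\<in>S. x i \<noteq> 0) \<and> (\<forall>j\<in>S. (\<Sum>i\<in>S. f i j * x i) = 0))"
proof -
  let ?A = "mat m m (\<lambda>(i, j). f (u i) (u j))"
  have "transpose_mat ?A = mat m m (\<lambda>(i, j). f (u j) (u i))"
    by (rule eq_matI) auto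
  then have "det ?A = det (mat m m (\<lambda>(i, j). (\<lambda>a b. f b a) (u i) (u j)))"
    using det_transpose[of ?A m] by simp
  then show ?thesis
    using det_reindexed_eq_0_iff[OF u, of "\<lambda>a b. f b a"] by simp
qed

section \<open>Nonsingularity of the reduced in-degree matrix as reachability from
  \<open>Z\<close>\<close>

text \<open>\<open>Z\<close> is the set of heads of the arcs leaving \<open>v\<^sup>*\<close>.\<close>
lemma det_reduced_in_degree_nonzero_iff:
  fixes E :: "'b rel"
  assumes u: "bij_betw u {..<m} S" and fin: "finite S" and E: "E \<subseteq> S \<times> S" and Z: "Z \<subseteq> S"
  defines "f \<equiv> \<lambda>i j. (if i = j then real (card {a \<in> S. (a, i) \<in> E}) + of_bool (i \<in> Z) else 0)
    - of_bool ((j, i) \<in> E)"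
  shows "det (mat m m (\<lambda>(i, j). f (u i) (u j))) \<noteq> 0 \<longleftrightarrow> S \<subseteq> E\<^sup>* `` Z"
proof
  \<comment> \<open>The diagonal entry counts the arcs entering \<open>i\<close>, so each of them
    contributes a difference of values at its ends. The last term is the difference along the arc
    from \<open>v\<^sup>*\<close>, where the value is 0.\<close>
  have row: "(\<Sum>j\<in>S. f i j * x j)
      = (\<Sum>j | j \<in> S \<and> (j, i) \<in> E. x i - x j) + of_bool (i \<in> Z) * x i" if "i \<in> S" for x i
  proof -
    have "(\<Sum>j\<in>S. f i j * x j)
        = (\<Sum>j\<in>S. (if i = j then (real (card {a \<in> S. (a, i) \<in> E}) + of_bool (i \<in> Z)) * x j else 0)
          - (if (j, i) \<in> E then x j else 0))"
      unfolding f_def by (intro sum.cong) (auto simp: algebra_simps)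
    also have "\<dots> = (real (card {a \<in> S. (a, i) \<in> E}) + of_bool (i \<in> Z)) * x i
        - (\<Sum>j | j \<in> S \<and> (j, i) \<in> E. x j)"
      using fin that by (simp add: sum_subtractf sum.inter_filter[symmetric])
    also have "\<dots> = (\<Sum>j | j \<in> S \<and> (j, i) \<in> E. x i - x j) + of_bool (i \<in> Z) * x i"
      by (simp add: sum_subtractf algebra_simps)
    finally show ?thesis .
  qed
  show "det (mat m m (\<lambda>(i, j). f (u i) (u j))) \<noteq> 0" if reach: "S \<subseteq> E\<^sup>* `` Z"
  proof
    assume "det (mat m m (\<lambda>(i, j). f (u i) (u j))) = 0"
    then obtain x :: "'b \<Rightarrow> real" where x: "\<exists>i\<in>S. x i \<noteq> 0"
      and null: "\<And>i. i \<in> S \<Longrightarrow> (\<Sum>j\<in>S. f i j * x j) = 0"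
      using det_reindexed_eq_0_iff[OF u, of f] by blast
    define M where "M = Max ((\<lambda>i. \<bar>x i\<bar>) ` S)"
    have le: "\<bar>x i\<bar> \<le> M" if "i \<in> S" for i
      unfolding M_def using fin that by simp
    have M: "M > 0" using x le by force
    have anc: "i \<notin> Z \<and> (\<forall>j. (j, i) \<in> E \<longrightarrow> \<bar>x j\<bar> = M)" if i: "i \<in> S" "\<bar>x i\<bar> = M" for i
    proof -
      \<comment> \<open>Multiplication by the sign of \<open>x i\<close> turns the row equation into
        a vanishing sum of nonnegative terms, so each term is 0. For \<open>i \<in> Z\<close> one of
        them would be \<open>M > 0\<close>.\<close>
      let ?c = "sgn (x i)" and ?I = "{j. j \<in> S \<and> (j, i) \<in> E}"
      have cM: "?c * x i = M" using i by (simp add: sgn_mult_self_eq abs_sgn mult.commute)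
      have c: "\<bar>?c\<bar> \<le> 1" by (simp add: sgn_if)
      have ge: "0 \<le> M - ?c * x j" if "j \<in> ?I" for j
      proof -
        have "?c * x j \<le> \<bar>?c\<bar> * \<bar>x j\<bar>" unfolding abs_mult[symmetric] by (rule abs_ge_self)
        also have "\<dots> \<le> 1 * M" using c le that by (intro mult_mono) auto
        finally show ?thesis by simp
      qed
      have "?c * ((\<Sum>j\<in>?I. x i - x j) + of_bool (i \<in> Z) * x i) = 0"
        using row[of i x] null i by simp
      then have "(\<Sum>j\<in>?I. M - ?c * x j) + of_bool (i \<in> Z) * M = 0"
        by (simp add: distrib_left sum_distrib_left right_diff_distrib mult.left_commute[of ?c] cM)
      moreover have "0 \<le> (\<Sum>j\<in>?I. M - ?c * x j)" using ge by (intro sum_nonneg)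
      ultimately have *: "(\<Sum>j\<in>?I. M - ?c * x j) = 0" "i \<notin> Z"
        using M by (auto simp: of_bool_def split: if_splits)
      have "\<forall>j\<in>?I. M - ?c * x j = 0"
        using sum_nonneg_eq_0_iff[of ?I "\<lambda>j. M - ?c * x j"] ge *(1) fin by simp
      then have "\<bar>x j\<bar> = M" if "(j, i) \<in> E" for j
        using that E M by (auto simp: sgn_if split: if_splits)
      with * show ?thesis by blast
    qed
    have "finite ((\<lambda>i. \<bar>x i\<bar>) ` S)" "(\<lambda>i. \<bar>x i\<bar>) ` S \<noteq> {}" using fin x by auto
    then have "M \<in> (\<lambda>i. \<bar>x i\<bar>) ` S" unfolding M_def by (rule Max_in)
    then obtain i where i: "i \<in> S" "\<bar>x i\<bar> = M" by auto
    then obtain z where z: "z \<in> Z" "(z, i) \<in> E\<^sup>*" using reach by auto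
    \<comment> \<open>The path is followed from \<open>i\<close> back to \<open>z\<close>; at each
      arc \<open>anc\<close> hands the modulus \<open>M\<close> from head to tail. At
      \<open>z\<close> itself \<open>anc\<close> then contradicts \<open>z \<in> Z\<close>.\<close>
    from z(2) have "z \<in> S \<and> \<bar>x z\<bar> = M"
    proof (induction rule: converse_rtrancl_induct)
      case (step y z)
      then show ?case using anc[of z] E by auto
    qed (use i in auto)
    with anc z(1) show False by blast
  qed
  show "S \<subseteq> E\<^sup>* `` Z" if "det (mat m m (\<lambda>(i, j). f (u i) (u j))) \<noteq> 0"
  proof (rule ccontr)
    assume "\<not> S \<subseteq> E\<^sup>* `` Z"
    define U where "U = S - E\<^sup>* `` Z"
    have U: "U \<noteq> {}" "U \<subseteq> S" using \<open>\<not> S \<subseteq> E\<^sup>* `` Z\<close> by (auto simp: U_def)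
    \<comment> \<open>A vertex with a reachable in-neighbour is reachable, so the rows of
      \<open>U\<close> vanish outside the columns of \<open>U\<close>.\<close>
    have closed: "j \<in> U" if "i \<in> U" "(j, i) \<in> E" for i j
      using that E unfolding U_def by (auto intro: rtrancl_into_rtrancl)
    have UZ: "i \<notin> Z" if "i \<in> U" for i using that by (auto simp: U_def)
    \<comment> \<open>Replacing the other rows by unit rows keeps the null vector and makes the left null
        vector supported in \<open>U\<close>.\<close>
    define g where "g = (\<lambda>i j. if i \<in> U then f i j else of_bool (i = j))"
    \<comment> \<open>The indicator of \<open>U\<close> is a null vector of \<open>g\<close>: in a
      row of \<open>U\<close> the differences vanish by \<open>closed\<close> and the last term by
      \<open>UZ\<close>; any other row is a unit row selecting a coordinate outside
      \<open>U\<close>.\<close>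
    have "(\<Sum>j\<in>S. g i j * of_bool (j \<in> U)) = 0" if "i \<in> S" for i
    proof (cases "i \<in> U")
      case True
      then have "(\<Sum>j\<in>S. g i j * of_bool (j \<in> U)) = (\<Sum>j\<in>S. f i j * of_bool (j \<in> U))"
        by (simp add: g_def)
      also have "\<dots> = 0"
        unfolding row[OF that] using closed True UZ by (auto intro!: sum.neutral)
      finally show ?thesis .
    next
      case False
      then show ?thesis by (intro sum.neutral) (auto simp: g_def)
    qed
    then have "\<exists>x. (\<exists>i\<in>S. x i \<noteq> 0) \<and> (\<forall>i\<in>S. (\<Sum>j\<in>S. g i j * x j) = 0)"
      using U by (intro exI[of _ "\<lambda>j. of_bool (j \<in> U)"]) auto
    then have "det (mat m m (\<lambda>(i, j). g (u i) (u j))) = 0"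
      using det_reindexed_eq_0_iff[OF u, of g] by blast
    then obtain y where y: "\<exists>i\<in>S. y i \<noteq> 0" and left: "\<And>j. j \<in> S \<Longrightarrow> (\<Sum>i\<in>S. g i j * y i) = 0"
      using det_reindexed_eq_0_iff_left[OF u, of g] by blast
    \<comment> \<open>For \<open>j\<close> outside \<open>U\<close> the column of \<open>g\<close>
      has its only nonzero entry on the diagonal, so the \<open>j\<close>-th left equation reads
      \<open>y j = 0\<close>.\<close>
    have y0: "y j = 0" if "j \<in> S - U" for j
    proof -
      have "f i j = 0" if "i \<in> U" for i
        using that \<open>j \<in> S - U\<close> closed by (auto simp: f_def)
      then have "(\<Sum>i\<in>S. g i j * y i) = (\<Sum>i\<in>S. if i = j then y i else 0)"
        using that by (intro sum.cong) (auto simp: g_def)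
      then show ?thesis using left[of j] that fin by simp
    qed
    \<comment> \<open>The rows where \<open>f\<close> and \<open>g\<close> differ are weighted by 0,
      so \<open>y\<close> is also a left null vector of \<open>f\<close>.\<close>
    have "(\<Sum>i\<in>S. f i j * y i) = 0" if "j \<in> S" for j
    proof -
      have "(\<Sum>i\<in>S. f i j * y i) = (\<Sum>i\<in>S. g i j * y i)"
        using y0 by (intro sum.cong) (auto simp: g_def)
      then show ?thesis using left[OF that] by simp
    qed
    with y have "det (mat m m (\<lambda>(i, j). f (u i) (u j))) = 0"
      using det_reindexed_eq_0_iff_left[OF u, of f] by blast
    with that show False by contradiction
  qed
qed

subsection \<open>Walks, rooted forests and depth\<close>

lemma pcas_snoc: "pcas u (p @ [e]) v \<longleftrightarrow> pcas u p (fst e) \<and> snd e = v"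
  by (induction p arbitrary: u) auto

lemma awalk_pair_iff:
  "pre_digraph.awalk (with_proj t) u p v \<longleftrightarrow> u \<in> pverts t \<and> set p \<subseteq> parcs t \<and> pcas u p v"
  by (simp add: pre_digraph.awalk_def cas_with_proj_eq)

lemma rtrancl_iff_pcas: "(u, v) \<in> E\<^sup>* \<longleftrightarrow> (\<exists>p. set p \<subseteq> E \<and> pcas u p v)"
proof
  assume "(u, v) \<in> E\<^sup>*"
  then show "\<exists>p. set p \<subseteq> E \<and> pcas u p v"
  proof induction
    case base
    show ?case by (intro exI[of _ "[]"]) simp
  next
    case (step v w)
    then obtain p where "set p \<subseteq> E" "pcas u p v" by blast
    with step show ?case by (intro exI[of _ "p @ [(v, w)]"]) (simp add: pcas_snoc)
  qed
next
  assume "\<exists>p. set p \<subseteq> E \<and> pcas u p v"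
  then obtain p where "set p \<subseteq> E" "pcas u p v" by blast
  then show "(u, v) \<in> E\<^sup>*"
    by (induction p arbitrary: u) (auto intro: converse_rtrancl_into_rtrancl)
qed

lemma ex1_eq: "\<lbrakk>\<exists>!x. P x; P x; P y\<rbrakk> \<Longrightarrow> x = y" by blast

text \<open>Read backwards from its end, a walk is forced if each vertex has at most one entering
  arc, and it must stop at a root if roots have none. Uniqueness of walks thus reduces to local
  conditions, and existence to reachability.\<close>

lemma rooted_forest_iff:
  "rooted_forest R F \<longleftrightarrow> pair_fin_digraph F \<and> R \<subseteq> pverts F
     \<and> (\<forall>(u, v)\<in>parcs F. v \<notin> R) \<and> (\<forall>u u' v. (u, v) \<in> parcs F \<longrightarrow> (u', v) \<in> parcs F \<longrightarrow> u = u')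
     \<and> pverts F \<subseteq> (parcs F)\<^sup>* `` R"
  (is "_ \<longleftrightarrow> ?fin \<and> ?R \<and> ?root \<and> ?uniq \<and> ?reach")
proof
  assume F: "rooted_forest R F"
  then have fin: ?fin and R: ?R
    unfolding rooted_forest_def by blast+
  have ex1: "\<exists>!(u, p). u \<in> R \<and> u \<in> pverts F \<and> set p \<subseteq> parcs F \<and> pcas u p v"
    if "v \<in> pverts F" for v
    using F that unfolding rooted_forest_def awalk_pair_iff by blast
  note in_arcsD = pair_wf_digraph.wellformed'[OF pair_fin_digraph.axioms(1)[OF fin]]
  have ex: "\<exists>w p. w \<in> R \<and> set p \<subseteq> parcs F \<and> pcas w p v" if "v \<in> pverts F" for v
    using ex1[OF that] by (elim ex1E) auto
  have eq: "w = w' \<and> p = p'" if "w \<in> R" "set p \<subseteq> parcs F" "pcas w p v"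
    "w' \<in> R" "set p' \<subseteq> parcs F" "pcas w' p' v" "v \<in> pverts F" for v w p w' p'
  proof -
    have "(w, p) = (w', p')"
      by (rule ex1_eq[OF ex1[OF that(7)]]) (use that R in auto)
    then show ?thesis by simp
  qed
  \<comment> \<open>An arc into a root \<open>v\<close> would complete a nonempty walk to
    \<open>v\<close>, competing with the empty walk from \<open>v\<close>.\<close>
  have ?root
  proof clarify
    fix u v assume uv: "(u, v) \<in> parcs F" "v \<in> R"
    then obtain w p where "w \<in> R" "set p \<subseteq> parcs F" "pcas w p u"
      using ex in_arcsD by blast
    then show False
      using eq[of w "p @ [(u, v)]" v v "[]"] uv in_arcsD by (auto simp: pcas_snoc)
  qed
  \<comment> \<open>Arcs from two tails into \<open>v\<close> would complete walks to
    \<open>v\<close> with different last arcs.\<close>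
  moreover have ?uniq
  proof clarify
    fix u u' v assume uv: "(u, v) \<in> parcs F" "(u', v) \<in> parcs F"
    obtain w p where "w \<in> R" "set p \<subseteq> parcs F" "pcas w p u"
      using ex uv in_arcsD by blast
    moreover obtain w' p' where "w' \<in> R" "set p' \<subseteq> parcs F" "pcas w' p' u'"
      using ex uv in_arcsD by blast
    ultimately show "u = u'"
      using eq[of w "p @ [(u, v)]" v w' "p' @ [(u', v)]"] uv in_arcsD by (auto simp: pcas_snoc)
  qed
  moreover have ?reach using ex by (auto simp: Image_iff rtrancl_iff_pcas) blast
  ultimately show "?fin \<and> ?R \<and> ?root \<and> ?uniq \<and> ?reach" using fin R by blast
next
  assume *: "?fin \<and> ?R \<and> ?root \<and> ?uniq \<and> ?reach"
  \<comment> \<open>Induction from the end of the walks: last arcs coincide because their heads do,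
    and an empty walk cannot compete with one entering a root.\<close>
  have eq: "w = w' \<and> p = p'" if "w \<in> R" "set p \<subseteq> parcs F" "pcas w p v"
    "w' \<in> R" "set p' \<subseteq> parcs F" "pcas w' p' v" for v w p w' p'
    using that
  proof (induction p arbitrary: v p' rule: rev_induct)
    case Nil
    then show ?case using * by (cases p' rule: rev_cases) (auto simp: pcas_snoc)
  next
    case (snoc e q)
    show ?case
    proof (cases p' rule: rev_cases)
      case Nil
      then show ?thesis using snoc.prems * by (auto simp: pcas_snoc)
    next
      case (snoc q' e')
      with snoc.prems have "(fst e, v) \<in> parcs F" "(fst e', v) \<in> parcs F" "snd e = snd e'"
        by (cases e; cases e'; auto simp: pcas_snoc)+
      then have "e = e'" using * by (metis prod.expand)
      with snoc snoc.prems snoc.IH[of "fst e" q'] show ?thesis by (simp add: pcas_snoc)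
    qed
  qed
  have ex1: "\<exists>!(u, p). u \<in> R \<and> u \<in> pverts F \<and> set p \<subseteq> parcs F \<and> pcas u p v" if v: "v \<in> pverts F" for v
  proof -
    obtain u p where up: "u \<in> R" "set p \<subseteq> parcs F" "pcas u p v"
      using * v unfolding rtrancl_iff_pcas Image_def by blast
    then show ?thesis
      using * eq[of _ _ v] by (intro ex1I[of _ "(u, p)"]) auto
  qed
  have "?fin" "?R" using * by blast+
  then show "rooted_forest R F"
    unfolding rooted_forest_def awalk_pair_iff by (intro conjI ballI ex1)
qed

lemma rooted_tree_iff_rooted_forest:
  fixes r :: 'a
  shows "rooted_tree r t \<longleftrightarrow> rooted_forest {r} t"
proof -
  have "(\<exists>!p. pre_digraph.awalk (with_proj t) r p v)
    \<longleftrightarrow> (\<exists>!(u, p). u \<in> {r} \<and> pre_digraph.awalk (with_proj t) u p v)" for v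
    unfolding Ex1_def by auto
  then show ?thesis
    unfolding rooted_tree_def rooted_forest_def by simp
qed

lemma rooted_tree_iff:
  "rooted_tree r t \<longleftrightarrow> pair_fin_digraph t \<and> r \<in> pverts t
     \<and> (\<forall>u. (u, r) \<notin> parcs t) \<and> (\<forall>u u' v. (u, v) \<in> parcs t \<longrightarrow> (u', v) \<in> parcs t \<longrightarrow> u = u')
     \<and> (\<forall>v\<in>pverts t. (r, v) \<in> (parcs t)\<^sup>*)"
  unfolding rooted_tree_iff_rooted_forest rooted_forest_iff by auto

text \<open>A natural-number substitute for the extended real \<open>dist_in\<close>. As a predicate
  that leaves values off the tree free, it allows one \<delta> to serve a spanning tree and all its
  truncations.\<close>

definition depth_function :: "'a \<Rightarrow> 'a pair_pre_digraph \<Rightarrow> ('a \<Rightarrow> nat) \<Rightarrow> bool" where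
  "depth_function r t \<delta> \<longleftrightarrow> \<delta> r = 0 \<and> (\<forall>(u, v)\<in>parcs t. \<delta> v = Suc (\<delta> u))"

text \<open>The length of the unique walk from the root works: appending an arc to the walk to its
  tail gives the walk to its head.\<close>

lemma ex_depth_function:
  assumes "rooted_tree r t"
  shows "\<exists>\<delta>. depth_function r t \<delta>"
proof -
  have "pair_fin_digraph t" using assms by (simp add: rooted_tree_def)
  note in_arcsD = pair_wf_digraph.wellformed'[OF pair_fin_digraph.axioms(1)[OF this]]
  let ?W = "\<lambda>v p. r \<in> pverts t \<and> set p \<subseteq> parcs t \<and> pcas r p v"
  have ex1: "\<exists>!p. ?W v p" if "v \<in> pverts t" for v
    using assms that unfolding rooted_tree_def awalk_pair_iff by blast
  define \<delta> where "\<delta> v = length (THE p. ?W v p)" for v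
  have \<delta>: "\<delta> v = length p" if "?W v p" "v \<in> pverts t" for v p
    using the1_equality[OF ex1[OF that(2)] that(1)] by (simp add: \<delta>_def)
  have r: "r \<in> pverts t" using assms by (simp add: rooted_tree_def)
  have "\<delta> r = 0" using \<delta>[where v = r and p = "[]"] r by simp
  moreover have "\<delta> v = Suc (\<delta> u)" if uv: "(u, v) \<in> parcs t" for u v
  proof -
    obtain p where p: "?W u p" using ex1 uv in_arcsD by blast
    then show ?thesis
      using \<delta>[where v = u and p = p] \<delta>[where v = v and p = "p @ [(u, v)]"] uv in_arcsD by (auto simp: pcas_snoc)
  qed
  ultimately show ?thesis unfolding depth_function_def by blast
qed

text \<open>The infimum defining the distance ranges over a single walk, whose number of arcs equals
  the increase of \<delta> along it.\<close>

lemma dist_in_eq_depth: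
  assumes t: "rooted_tree r t" and \<delta>: "depth_function r t \<delta>" and v: "v \<in> pverts t"
  shows "dist_in t r v = ereal (real (\<delta> v))"
proof -
  interpret pair_fin_digraph t using t by (simp add: rooted_tree_def)
  have len: "\<delta> b = \<delta> a + length p" if "set p \<subseteq> parcs t" "pcas a p b" for a b p
    using that \<delta> by (induction p arbitrary: a) (auto simp: depth_function_def)
  obtain p where p: "{p. pre_digraph.awalk (with_proj t) r p v} = {p}"
  proof -
    have "\<exists>!p. pre_digraph.awalk (with_proj t) r p v"
      using t v unfolding rooted_tree_def by blast
    then show ?thesis using that by (elim ex1E) blast
  qed
  then have "pre_digraph.awalk (with_proj t) r p v" by blast
  then have "\<delta> v = length p"
    using len[of p r v] \<delta> by (simp add: awalk_pair_iff depth_function_def)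
  moreover have "awalk_cost (\<lambda>_. 1) p = real (length p)"
    by (induction p) auto
  ultimately show ?thesis
    unfolding dist_in_def \<mu>_def p by simp
qed

section \<open>Set-level criteria for subgraphs, rooted forests and tree length\<close>

lemma wf_digraph_with_proj_iff:
  "wf_digraph (with_proj H) \<longleftrightarrow> parcs H \<subseteq> pverts H \<times> pverts H"
  by (auto simp: wf_digraph_def)

lemma subgraph_with_proj_iff:
  "subgraph (with_proj H) (with_proj G) \<longleftrightarrow> pverts H \<subseteq> pverts G \<and> parcs H \<subseteq> parcs G
     \<and> parcs G \<subseteq> pverts G \<times> pverts G \<and> parcs H \<subseteq> pverts H \<times> pverts H"
  by (auto simp: subgraph_def compatible_def wf_digraph_with_proj_iff)

lemma pair_fin_digraph_iff:
  "pair_fin_digraph H \<longleftrightarrow> finite (pverts H) \<and> parcs H \<subseteq> pverts H \<times> pverts H"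
proof
  assume "pair_fin_digraph H"
  then interpret pair_fin_digraph H .
  show "finite (pverts H) \<and> parcs H \<subseteq> pverts H \<times> pverts H"
    using pair_finite_verts in_arcsD1 in_arcsD2 by auto
next
  assume "finite (pverts H) \<and> parcs H \<subseteq> pverts H \<times> pverts H"
  then show "pair_fin_digraph H"
    by unfold_locales (auto intro: finite_subset)
qed

text \<open>Passing to the parent strictly lowers \<delta>, so the ascent ends, and it can end only
  in \<open>R\<close>. This excludes cycles and gives reachability from the roots.\<close>

lemma rooted_forestI:
  fixes \<delta> :: "'a \<Rightarrow> nat"
  assumes fin: "pair_fin_digraph F" and R: "R \<subseteq> pverts F"
    and root: "\<And>u v. (u, v) \<in> parcs F \<Longrightarrow> v \<notin> R"
    and depth: "\<And>u v. (u, v) \<in> parcs F \<Longrightarrow> \<delta> u < \<delta> v"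
    and parent: "\<And>v. v \<in> pverts F - R \<Longrightarrow> \<exists>!u. (u, v) \<in> parcs F"
  shows "rooted_forest R F"
proof -
  have E: "parcs F \<subseteq> pverts F \<times> pverts F" using fin by (simp add: pair_fin_digraph_iff)
  have "v \<in> (parcs F)\<^sup>* `` R" if "v \<in> pverts F" for v
    using that
  proof (induction "\<delta> v" arbitrary: v rule: less_induct)
    case less
    show ?case
    proof (cases "v \<in> R")
      case False
      then obtain u where "(u, v) \<in> parcs F" using parent less.prems by blast
      with less.hyps[of u] depth E show ?thesis by (auto intro: rtrancl_into_rtrancl)
    qed auto
  qed
  moreover have "u = u'" if "(u, v) \<in> parcs F" "(u', v) \<in> parcs F" for u u' v
    using parent[of v] root that E by blast
  ultimately show ?thesis
    unfolding rooted_forest_iff using fin R root by blast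
qed

lemma rooted_treeI:
  assumes "pair_fin_digraph t" "r \<in> pverts t" and \<delta>: "depth_function r t \<delta>"
    and "\<And>v. v \<in> pverts t - {r} \<Longrightarrow> \<exists>!u. (u, v) \<in> parcs t"
  shows "rooted_tree r t"
  unfolding rooted_tree_iff_rooted_forest
  by (rule rooted_forestI[where \<delta> = \<delta>]) (use assms in \<open>auto simp: depth_function_def\<close>)

lemma rooted_tree_parent:
  assumes "rooted_tree r t" "v \<in> pverts t - {r}"
  shows "\<exists>!u. (u, v) \<in> parcs t"
proof -
  have "(r, v) \<in> (parcs t)\<^sup>*" "v \<noteq> r" using assms by (auto simp: rooted_tree_iff)
  then obtain u where "(u, v) \<in> parcs t" by (auto elim: rtranclE)
  then show ?thesis using assms by (auto simp: rooted_tree_iff)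
qed

lemma depth_eq_0_iff:
  assumes "rooted_tree r t" "depth_function r t \<delta>" "v \<in> pverts t"
  shows "\<delta> v = 0 \<longleftrightarrow> v = r"
proof
  assume "\<delta> v = 0"
  then have "(u, v) \<notin> parcs t" for u using assms(2) by (auto simp: depth_function_def)
  then show "v = r" using rooted_tree_parent[OF assms(1), of v] assms(3) by blast
qed (use assms(2) in \<open>simp add: depth_function_def\<close>)

lemma tree_length_eq_iff:
  assumes t: "rooted_tree r t" and \<delta>: "depth_function r t \<delta>"
  shows "tree_length r t = ereal (real m)
    \<longleftrightarrow> (\<forall>v\<in>pverts t. \<delta> v \<le> m) \<and> (\<exists>v\<in>pverts t. \<delta> v = m)"
proof -
  have "finite (pverts t)" "pverts t \<noteq> {}"
    using t by (auto simp: rooted_tree_def pair_fin_digraph_iff)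
  moreover have "dist_in t r ` pverts t = (\<lambda>v. ereal (real (\<delta> v))) ` pverts t"
    using dist_in_eq_depth[OF t \<delta>] by auto
  ultimately show ?thesis
    unfolding tree_length_def by (simp add: Max_eq_iff) auto
qed

subsection \<open>Truncated spanning trees\<close>

text \<open>Only heads of arcs are tested: with \<delta> a depth function, the tail lies one level
  nearer to the root.\<close>

definition truncate_tree :: "('a \<Rightarrow> nat) \<Rightarrow> 'a pair_pre_digraph \<Rightarrow> nat \<Rightarrow> 'a pair_pre_digraph" where
  "truncate_tree \<delta> s j =
     \<lparr> pverts = {v \<in> pverts s. \<delta> v \<le> j}, parcs = {(u, v) \<in> parcs s. \<delta> v \<le> j} \<rparr>"

lemma depth_function_truncate_tree:
  "depth_function r s \<delta> \<Longrightarrow> depth_function r (truncate_tree \<delta> s j) \<delta>"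
  by (auto simp: depth_function_def truncate_tree_def)

lemma rooted_tree_truncate_tree:
  assumes s: "rooted_tree r s" and \<delta>: "depth_function r s \<delta>"
  shows "rooted_tree r (truncate_tree \<delta> s j)"
proof (rule rooted_treeI[OF _ _ depth_function_truncate_tree[OF \<delta>]])
  have fin: "finite (pverts s)" "parcs s \<subseteq> pverts s \<times> pverts s"
    using s by (auto simp: rooted_tree_def pair_fin_digraph_iff)
  then show "pair_fin_digraph (truncate_tree \<delta> s j)"
    using \<delta> by (auto simp: pair_fin_digraph_iff truncate_tree_def depth_function_def)
  show "r \<in> pverts (truncate_tree \<delta> s j)"
    using s \<delta> by (auto simp: truncate_tree_def rooted_tree_def depth_function_def)
  show "\<exists>!u. (u, v) \<in> parcs (truncate_tree \<delta> s j)"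
    if "v \<in> pverts (truncate_tree \<delta> s j) - {r}" for v
    using rooted_tree_parent[OF s, of v] that by (simp add: truncate_tree_def)
qed

text \<open>The part of \<open>s\<close> cut off below level \<open>j\<close> is itself the required
  extension, so gluing it back returns \<open>s\<close>.\<close>

lemma truncate_tree_extends:
  assumes s: "rooted_spanning_tree G r s" and \<delta>: "depth_function r s \<delta>"
  shows "extends_to_spanning_tree G r j (truncate_tree \<delta> s j)"
proof -
  let ?t = "truncate_tree \<delta> s j"
  have t: "rooted_tree r s" and sub: "subgraph (with_proj s) (with_proj G)"
    and V: "pverts s = pverts G"
    using s by (auto simp: rooted_spanning_tree_def spanning_def)
  have E: "parcs s \<subseteq> parcs G" "parcs s \<subseteq> pverts s \<times> pverts s"
    "parcs G \<subseteq> pverts G \<times> pverts G" "finite (pverts s)"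
    using sub t by (auto simp: subgraph_with_proj_iff rooted_tree_def pair_fin_digraph_iff)
  have step: "\<delta> v = Suc (\<delta> u)" if "(u, v) \<in> parcs s" for u v
    using \<delta> that by (auto simp: depth_function_def)
  \<comment> \<open>The arcs of \<open>s\<close> split by level: those within depth \<open>j\<close>
    form \<open>?t\<close>, those leaving level \<open>j\<close> form \<open>C\<close>, and those
    starting deeper form \<open>F\<close>, whose roots \<open>R\<close> are the vertices of level
    \<open>j + 1\<close>.\<close>
  define F where "F = \<lparr> pverts = {v \<in> pverts s. j < \<delta> v}, parcs = {(u, v) \<in> parcs s. j < \<delta> u} \<rparr>"
  define R where "R = {v \<in> pverts s. \<delta> v = Suc j}"
  define C where "C = {(u, v) \<in> parcs s. \<delta> u = j}"
  have "subgraph (with_proj F) (with_proj (delete_verts_of G ?t))"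
    using E V step by (fastforce simp: subgraph_with_proj_iff F_def delete_verts_of_def truncate_tree_def)
  moreover have "rooted_forest R F"
  proof (rule rooted_forestI[where \<delta> = \<delta>])
    show "pair_fin_digraph F"
      using E step by (fastforce simp: pair_fin_digraph_iff F_def)
    show "\<exists>!u. (u, v) \<in> parcs F" if "v \<in> pverts F - R" for v
    proof -
      have "v \<in> pverts s" "Suc j < \<delta> v" using that by (auto simp: F_def R_def)
      then have "\<exists>!u. (u, v) \<in> parcs s"
        using rooted_tree_parent[OF t, of v] depth_eq_0_iff[OF t \<delta>, of v] by auto
      moreover have "(u, v) \<in> parcs F \<longleftrightarrow> (u, v) \<in> parcs s" for u
        using step[of u v] \<open>Suc j < \<delta> v\<close> by (auto simp: F_def)
      ultimately show ?thesis by simp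
    qed
  qed (use step in \<open>auto simp: F_def R_def\<close>)
  moreover have "C \<subseteq> parcs G \<inter> (leaves_at r ?t j \<times> R)"
  proof clarify
    fix u v assume "(u, v) \<in> C"
    then have uv: "(u, v) \<in> parcs s" "\<delta> u = j" by (auto simp: C_def)
    then have u: "u \<in> pverts ?t" using E by (auto simp: truncate_tree_def)
    have "dist_in ?t r u = ereal (real j)"
      using dist_in_eq_depth[OF rooted_tree_truncate_tree[OF t \<delta>]
          depth_function_truncate_tree[OF \<delta>] u] uv by simp
    \<comment> \<open>All arcs of \<open>s\<close> leaving depth \<open>j\<close> have heads at
      depth \<open>j + 1\<close>, hence are cut away.\<close>
    moreover have "out_arcs (with_proj ?t) u = {}"
      using uv step by (fastforce simp: out_arcs_def truncate_tree_def)
    ultimately have "u \<in> leaves_at r ?t j" using u by (simp add: leaves_at_def)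
    then show "(u, v) \<in> parcs G \<inter> (leaves_at r ?t j \<times> R)"
      using uv E step[of u v] by (auto simp: R_def)
  qed
  moreover have "\<lparr> pverts = pverts ?t \<union> pverts F, parcs = parcs ?t \<union> C \<union> parcs F \<rparr> = s"
  proof -
    have "pverts ?t \<union> pverts F = pverts s" by (auto simp: truncate_tree_def F_def)
    moreover have "parcs ?t \<union> C \<union> parcs F = parcs s"
      using step by (fastforce simp: truncate_tree_def F_def C_def)
    ultimately show ?thesis by simp
  qed
  ultimately show ?thesis
    unfolding extends_to_spanning_tree_def using s by metis
qed

text \<open>Induction on the level, each truncation growing from the previous one. The vertex
  \<open>v\<close> certifies that level \<open>j\<close> is occupied, so that the length is exactly
  \<open>j\<close>; projectivity passes to smaller truncations.\<close>

lemma truncate_tree_pre_spanning: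
  assumes s: "rooted_spanning_tree G r s" and \<delta>: "depth_function r s \<delta>"
    and "projective ix (truncate_tree \<delta> s j)" and "v \<in> pverts s" "\<delta> v = j"
  shows "truncate_tree \<delta> s j \<in> pre_spanning_trees G ix r j"
  using assms(3-)
proof (induction j arbitrary: v)
  case 0
  have t: "rooted_tree r s" using s by (simp add: rooted_spanning_tree_def)
  then have "{v \<in> pverts s. \<delta> v = 0} = {r}"
    using depth_eq_0_iff[OF t \<delta>] by (auto simp: rooted_tree_def)
  moreover have "{(u, v) \<in> parcs s. \<delta> v = 0} = {}"
    using \<delta> by (auto simp: depth_function_def)
  ultimately have "truncate_tree \<delta> s 0 = \<lparr> pverts = {r}, parcs = {} \<rparr>"
    by (simp add: truncate_tree_def)
  then show ?case using s by auto
next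
  case (Suc j)
  let ?t = "truncate_tree \<delta> s"
  have t: "rooted_tree r s" and sub: "subgraph (with_proj s) (with_proj G)"
    using s by (auto simp: rooted_spanning_tree_def spanning_def)
  have E: "parcs s \<subseteq> parcs G" "parcs s \<subseteq> pverts s \<times> pverts s" "pverts s \<subseteq> pverts G"
    "parcs G \<subseteq> pverts G \<times> pverts G"
    using sub by (auto simp: subgraph_with_proj_iff)
  have step: "\<delta> v = Suc (\<delta> u)" if "(u, v) \<in> parcs s" for u v
    using \<delta> that by (auto simp: depth_function_def)
  note tj = rooted_tree_truncate_tree[OF t \<delta>] and dj = depth_function_truncate_tree[OF \<delta>]
  have parent: "\<exists>u. (u, v) \<in> parcs s" if "v \<in> pverts s" "\<delta> v = Suc j" for v
    using rooted_tree_parent[OF t, of v] that depth_eq_0_iff[OF t \<delta>, of v] by auto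
  \<comment> \<open>The parent of \<open>v\<close> certifies that level \<open>j\<close> is
    occupied, as the induction hypothesis demands.\<close>
  then obtain u where u: "(u, v) \<in> parcs s" using Suc.prems by blast
  have "projective ix (?t j)"
    using Suc.prems(1) by (auto simp: projective_def truncate_tree_def)
  then have IH: "?t j \<in> pre_spanning_trees G ix r j"
    using Suc.IH[of u] u E step[OF u] Suc.prems by auto
  have "subgraph (with_proj (?t (Suc j))) (with_proj G)"
    using tj[of "Suc j"] E
    by (auto simp: subgraph_with_proj_iff rooted_tree_def pair_fin_digraph_iff truncate_tree_def)
  moreover have "tree_length r (?t (Suc j)) = ereal (real (Suc j))"
    unfolding tree_length_eq_iff[OF tj dj]
    using Suc.prems by (auto simp: truncate_tree_def)
  moreover have "grown_from G ix r j (?t j) (?t (Suc j))"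
    unfolding grown_from_def
  proof (intro exI conjI)
    \<comment> \<open>The new arcs are those entering level \<open>j + 1\<close>; their tails are
      leaves of the smaller truncation.\<close>
    let ?N = "{(u, v) \<in> parcs s. \<delta> v = Suc j}"
    show "?N \<subseteq> parcs G - parcs (?t j)" using E by (auto simp: truncate_tree_def)
    show "fst ` ?N \<subseteq> leaves_at r (?t j) j"
    proof clarsimp
      fix a b assume ab: "(a, b) \<in> parcs s" "\<delta> b = Suc j"
      then have a: "\<delta> a = j" "a \<in> pverts (?t j)"
        using step[of a b] E by (auto simp: truncate_tree_def)
      moreover have "out_arcs (with_proj (?t j)) a = {}"
        using a step by (fastforce simp: out_arcs_def truncate_tree_def)
      ultimately show "a \<in> leaves_at r (?t j) j"
        using dist_in_eq_depth[OF tj dj, of a j] by (simp add: leaves_at_def)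
    qed
    show "\<forall>e\<in>?N. \<forall>f\<in>?N \<union> parcs (?t j). \<not> in_conflict ix e f"
      using Suc.prems(1) by (fastforce simp: projective_def truncate_tree_def)
    show "pverts (?t (Suc j)) = pverts (?t j) \<union> snd ` ?N"
    proof
      show "pverts (?t (Suc j)) \<subseteq> pverts (?t j) \<union> snd ` ?N"
      proof
        fix x assume x: "x \<in> pverts (?t (Suc j))"
        show "x \<in> pverts (?t j) \<union> snd ` ?N"
        proof (cases "\<delta> x = Suc j")
          case True
          then obtain y where "(y, x) \<in> parcs s"
            using x parent by (auto simp: truncate_tree_def)
          then show ?thesis using True by force
        qed (use x in \<open>auto simp: truncate_tree_def\<close>)
      qed
      show "pverts (?t j) \<union> snd ` ?N \<subseteq> pverts (?t (Suc j))"
        using E by (auto simp: truncate_tree_def)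
    qed
    show "parcs (?t (Suc j)) = parcs (?t j) \<union> ?N" by (auto simp: truncate_tree_def le_Suc_eq)
  qed
  ultimately show ?case
    using IH tj[of "Suc j"] Suc.prems(1) truncate_tree_extends[OF s \<delta>, of "Suc j"] by auto
qed

subsection \<open>Extendability is reachability from \<open>v\<^sup>*\<close>\<close>

text \<open>On the path from \<open>r\<close> in the spanning tree, the arc leaving
  \<open>t'\<close> belongs to \<open>C\<close>, so its head lies in
  \<open>attach_verts G r k t'\<close>; from there on the path uses arcs of
  \<open>F\<close>.\<close>

lemma extends_imp_reachable:
  assumes t: "rooted_tree r t'"
    and ext: "extends_to_spanning_tree G r (k + 1) t'"
  shows "pverts (delete_verts_of G t')
    \<subseteq> (parcs (delete_verts_of G t'))\<^sup>* `` attach_verts G r k t'"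
proof -
  let ?S = "pverts (delete_verts_of G t')" and ?E = "parcs (delete_verts_of G t')"
    and ?Z = "attach_verts G r k t'"
  obtain F R C where F: "subgraph (with_proj F) (with_proj (delete_verts_of G t'))"
    and R: "rooted_forest R F" and C: "C \<subseteq> parcs G \<inter> (leaves_at r t' (k + 1) \<times> R)"
    and s: "rooted_spanning_tree G r
      \<lparr> pverts = pverts t' \<union> pverts F, parcs = parcs t' \<union> C \<union> parcs F \<rparr>"
    (is "rooted_spanning_tree G r ?s")
    using ext unfolding extends_to_spanning_tree_def by blast
  have F: "parcs F \<subseteq> ?E" "pverts F \<subseteq> ?S" "parcs F \<subseteq> pverts F \<times> pverts F"
    using F by (auto simp: subgraph_with_proj_iff)
  have RF: "R \<subseteq> pverts F" using R by (simp add: rooted_forest_def)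
  have "v \<in> ?E\<^sup>* `` ?Z" if "v \<in> ?S" for v
  proof -
    have "v \<in> pverts ?s" "rooted_tree r ?s"
      using s that by (auto simp: rooted_spanning_tree_def spanning_def delete_verts_of_def)
    then have "(r, v) \<in> (parcs ?s)\<^sup>*" by (simp add: rooted_tree_iff)
    \<comment> \<open>The implication lets the induction run through the initial stretch of the path
      inside \<open>t'\<close>, where nothing is claimed.\<close>
    then have "v \<in> ?S \<longrightarrow> v \<in> ?E\<^sup>* `` ?Z"
    proof induction
      case base
      show ?case using t by (simp add: delete_verts_of_def rooted_tree_def)
    next
      case (step u v)
      show ?case
      proof
        assume v: "v \<in> ?S"
        consider "(u, v) \<in> parcs t'" | "(u, v) \<in> C" | "(u, v) \<in> parcs F"
          using step.hyps by auto
        then show "v \<in> ?E\<^sup>* `` ?Z"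
        proof cases
          case 1
          then show ?thesis using t v by (auto simp: rooted_tree_iff pair_fin_digraph_iff delete_verts_of_def)
        next
          case 2
          then have "v \<in> ?Z"
            using C v by (fastforce simp: attach_verts_def leaves_at_def)
          then show ?thesis by blast
        next
          case 3
          then show ?thesis using step.IH F by (auto intro: rtrancl_into_rtrancl)
        qed
      qed
    qed
    with that show ?thesis by blast
  qed
  then show ?thesis by blast
qed

text \<open>Breadth-first search from \<open>Z\<close> supplies each new vertex with a parent
  exactly one level above it. All new depths exceed \<open>k + 1\<close>, so truncation at that
  depth recovers \<open>t'\<close>.\<close>

lemma reachable_imp_ex_spanning_tree:
  assumes G: "pair_fin_digraph G" and sub: "subgraph (with_proj t') (with_proj G)"
    and t': "rooted_tree r t'" and len: "tree_length r t' = ereal (real (k + 1))"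
    and reach: "pverts (delete_verts_of G t')
      \<subseteq> (parcs (delete_verts_of G t'))\<^sup>* `` attach_verts G r k t'"
  obtains s \<delta> where "rooted_spanning_tree G r s" "depth_function r s \<delta>"
    "truncate_tree \<delta> s (k + 1) = t'" "\<exists>v\<in>pverts s. \<delta> v = k + 1"
proof -
  define S where "S = pverts (delete_verts_of G t')"
  define E where "E = parcs (delete_verts_of G t')"
  define Z where "Z = attach_verts G r k t'"
  have GV: "finite (pverts G)" "parcs G \<subseteq> pverts G \<times> pverts G"
    using G by (auto simp: pair_fin_digraph_iff)
  have tV: "pverts t' \<subseteq> pverts G" "parcs t' \<subseteq> parcs G" "parcs t' \<subseteq> pverts t' \<times> pverts t'"
    using sub by (auto simp: subgraph_with_proj_iff)
  have S: "S = pverts G - pverts t'" and E: "E = parcs G \<inter> S \<times> S"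
    using GV by (auto simp: S_def E_def delete_verts_of_def)
  have ZS: "Z \<subseteq> S" by (auto simp: Z_def S_def attach_verts_def)
  obtain \<delta>' where \<delta>': "depth_function r t' \<delta>'" using ex_depth_function[OF t'] by blast
  have rt: "r \<in> pverts t'" using t' by (simp add: rooted_tree_def)
  have le: "\<And>v. v \<in> pverts t' \<Longrightarrow> \<delta>' v \<le> k + 1" and ex: "\<exists>v\<in>pverts t'. \<delta>' v = k + 1"
    using len tree_length_eq_iff[OF t' \<delta>', of "k + 1"] by auto
  have Zpar: "\<exists>d\<in>pverts t'. \<delta>' d = k + 1 \<and> (d, z) \<in> parcs G" if z: "z \<in> Z" for z
  proof -
    obtain d where d: "d \<in> pverts t'" "dist_in t' r d = ereal (real (k + 1))" "(d, z) \<in> parcs G"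
      using z unfolding Z_def attach_verts_def by blast
    then have "\<delta>' d = k + 1" using dist_in_eq_depth[OF t' \<delta>', of d] by simp
    with d show ?thesis by blast
  qed
  define P where "P v n \<longleftrightarrow> (\<exists>z\<in>Z. (z, v) \<in> E ^^ n)" for v n
  \<comment> \<open>The length of a shortest path in \<open>E\<close> from \<open>Z\<close>.\<close>
  define m where "m v = (LEAST n. P v n)" for v
  have P: "\<exists>n. P v n" if "v \<in> S" for v
  proof -
    have "v \<in> E\<^sup>* `` Z" using reach that unfolding S_def E_def Z_def by blast
    then show ?thesis unfolding P_def by (auto simp: rtrancl_power) blast
  qed
  \<comment> \<open>Vertices of \<open>Z\<close> hang on vertices of \<open>t'\<close> at depth
    \<open>k + 1\<close>, hence start at depth \<open>k + 2\<close>.\<close>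
  define \<delta> where "\<delta> v = (if v \<in> pverts t' then \<delta>' v else k + 2 + m v)" for v
  have par: "\<exists>u. (u, v) \<in> parcs G \<and> \<delta> v = Suc (\<delta> u)" if v: "v \<in> S" for v
  proof -
    have Pm: "P v (m v)" unfolding m_def using P[OF v] by (rule LeastI_ex)
    have dv: "\<delta> v = k + 2 + m v" using v by (simp add: \<delta>_def S)
    show ?thesis
    proof (cases "m v")
      case 0
      then have "v \<in> Z" using Pm by (auto simp: P_def)
      then obtain d where "d \<in> pverts t'" "\<delta>' d = k + 1" "(d, v) \<in> parcs G" using Zpar by blast
      then show ?thesis using dv 0 by (intro exI[of _ d]) (simp add: \<delta>_def)
    next
      case (Suc n)
      then obtain u where u: "P u n" "(u, v) \<in> E" using Pm by (auto simp: P_def)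
      have "m u \<le> n" unfolding m_def using u(1) by (rule Least_le)
      \<comment> \<open>Minimality of \<open>m v\<close> yields this bound; equality is needed
        because depth must grow by exactly one along the arc.\<close>
      moreover have "n \<le> m u"
      proof -
        have "P u (m u)" unfolding m_def using u(1) by (rule LeastI)
        then have "P v (Suc (m u))" using u(2) by (auto simp: P_def)
        then have "m v \<le> Suc (m u)" unfolding m_def by (rule Least_le)
        then show ?thesis using Suc by simp
      qed
      ultimately show ?thesis
        using u dv Suc by (intro exI[of _ u]) (auto simp: \<delta>_def E S)
    qed
  qed
  then have "\<forall>v\<in>S. \<exists>u. (u, v) \<in> parcs G \<and> \<delta> v = Suc (\<delta> u)" by blast
  then obtain par where par: "\<And>v. v \<in> S \<Longrightarrow> (par v, v) \<in> parcs G \<and> \<delta> v = Suc (\<delta> (par v))"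
    unfolding bchoice_iff by blast
  define s where "s = \<lparr> pverts = pverts G, parcs = parcs t' \<union> {(par v, v) | v. v \<in> S} \<rparr>"
  have ds: "depth_function r s \<delta>"
    using \<delta>' par rt tV by (fastforce simp: depth_function_def \<delta>_def s_def)
  have sG: "parcs s \<subseteq> parcs G" using par tV by (auto simp: s_def)
  have "rooted_tree r s"
  proof (rule rooted_treeI[OF _ _ ds])
    show "pair_fin_digraph s" using GV sG by (auto simp: pair_fin_digraph_iff s_def)
    show "r \<in> pverts s" using rt tV by (auto simp: s_def)
    show "\<exists>!u. (u, v) \<in> parcs s" if "v \<in> pverts s - {r}" for v
    proof (cases "v \<in> pverts t'")
      case True
      then have "(u, v) \<in> parcs s \<longleftrightarrow> (u, v) \<in> parcs t'" for u by (auto simp: s_def S)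
      then show ?thesis using rooted_tree_parent[OF t', of v] True that by simp
    next
      case False
      then have "(u, v) \<in> parcs s \<longleftrightarrow> u = par v" for u
        using that tV by (auto simp: s_def S)
      then show ?thesis by simp
    qed
  qed
  then have "rooted_spanning_tree G r s"
    using sG GV by (auto simp: rooted_spanning_tree_def spanning_def subgraph_with_proj_iff s_def)
  moreover have "truncate_tree \<delta> s (k + 1) = t'"
  proof -
    have dl: "\<delta> v \<le> k + 1 \<longleftrightarrow> v \<in> pverts t'" for v using le by (auto simp: \<delta>_def)
    have "{v \<in> pverts s. \<delta> v \<le> k + 1} = pverts t'" unfolding dl using tV by (auto simp: s_def)
    moreover have "{(u, v) \<in> parcs s. \<delta> v \<le> k + 1} = parcs t'"
      unfolding dl using tV by (auto simp: s_def S)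
    ultimately show ?thesis by (simp add: truncate_tree_def)
  qed
  moreover have "\<exists>v\<in>pverts s. \<delta> v = k + 1" using ex tV by (auto simp: \<delta>_def s_def)
  ultimately show thesis using ds that by blast
qed

text \<open>The extension clause of membership forces reachability. Conversely, \<open>t'\<close> is
  a projective truncation of the breadth-first spanning tree.\<close>

lemma pre_spanning_iff_reachable:
  assumes G: "pair_fin_digraph G" and sub: "subgraph (with_proj t') (with_proj G)"
    and t': "rooted_tree r t'" and proj: "projective ix t'"
    and len: "tree_length r t' = ereal (real (k + 1))"
  shows "t' \<in> pre_spanning_trees G ix r (k + 1)
    \<longleftrightarrow> pverts (delete_verts_of G t')
      \<subseteq> (parcs (delete_verts_of G t'))\<^sup>* `` attach_verts G r k t'"
proof
  assume "t' \<in> pre_spanning_trees G ix r (k + 1)"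
  then have "extends_to_spanning_tree G r (k + 1) t'" by simp
  then show "pverts (delete_verts_of G t')
      \<subseteq> (parcs (delete_verts_of G t'))\<^sup>* `` attach_verts G r k t'"
    by (rule extends_imp_reachable[OF t'])
next
  assume "pverts (delete_verts_of G t')
      \<subseteq> (parcs (delete_verts_of G t'))\<^sup>* `` attach_verts G r k t'"
  then obtain s \<delta> v where "rooted_spanning_tree G r s" "depth_function r s \<delta>"
    "truncate_tree \<delta> s (k + 1) = t'" "v \<in> pverts s" "\<delta> v = k + 1"
    using reachable_imp_ex_spanning_tree[OF G sub t' len] by blast
  then show "t' \<in> pre_spanning_trees G ix r (k + 1)"
    using truncate_tree_pre_spanning[of G r s \<delta> ix "k + 1" v] proj by simp
qed

subsection \<open>The reduced in-degree matrix of \<open>G(t')\<close>\<close>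

lemma parcs_contracted_digraph_iff:
  "(Some a, Some b) \<in> parcs (contracted_digraph G r k t') \<longleftrightarrow> (a, b) \<in> parcs (delete_verts_of G t')"
  by (auto simp: contracted_digraph_def image_iff map_prod_def split: prod.splits)

lemma in_degree_contracted_digraph:
  fixes G t' :: "'a pair_pre_digraph"
  assumes G: "pair_fin_digraph G"
  shows "in_degree (with_proj (contracted_digraph G r k t')) (Some i)
    = card {a \<in> pverts (delete_verts_of G t'). (a, i) \<in> parcs (delete_verts_of G t')}
      + of_bool (i \<in> attach_verts G r k t')"
proof -
  let ?S = "pverts (delete_verts_of G t')" and ?E = "parcs (delete_verts_of G t')"
    and ?Z = "attach_verts G r k t'"
  let ?A = "{a \<in> ?S. (a, i) \<in> ?E}" and ?I = "(if i \<in> ?Z then {(None :: 'a option, Some i)} else {})"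
  have "?E \<subseteq> ?S \<times> ?S" and fin: "finite ?S"
    using G by (auto simp: delete_verts_of_def pair_fin_digraph_iff)
  then have "in_arcs (with_proj (contracted_digraph G r k t')) (Some i)
      = (\<lambda>a. (Some a, Some i)) ` ?A \<union> ?I"
    unfolding in_arcs_def contracted_digraph_def
    by (auto simp: image_iff map_prod_def split: prod.splits)
  moreover have "card ((\<lambda>a. (Some a, Some i)) ` ?A \<union> ?I)
      = card ((\<lambda>a. (Some a, Some i)) ` ?A) + card ?I"
    using fin by (intro card_Un_disjoint) auto
  moreover have "card ((\<lambda>a. (Some a, Some i)) ` ?A) = card ?A"
    by (intro card_image) (auto simp: inj_on_def)
  ultimately show ?thesis by (simp add: in_degree_def)
qed

text \<open>Skipping position \<open>p\<close> in \<open>vs\<close> and stripping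
  \<open>Some\<close> enumerates \<open>S\<close>. The entries are stated as a function of two
  vertices evaluated at \<open>u i\<close> and \<open>u j\<close>, the form required by
  \<open>det_reduced_in_degree_nonzero_iff\<close>.\<close>

lemma mat_delete_in_degree_matrix:
  fixes G t' :: "'a pair_pre_digraph"
  assumes G: "pair_fin_digraph G"
    and vs: "distinct vs" "set vs = pverts (contracted_digraph G r k t')"
    and p: "p < length vs" "vs ! p = None"
  defines "E \<equiv> parcs (delete_verts_of G t')" and "S \<equiv> pverts (delete_verts_of G t')"
  obtains u where "bij_betw u {..<length vs - 1} S"
    "mat_delete (in_degree_matrix (contracted_digraph G r k t') vs) p p
      = mat (length vs - 1) (length vs - 1) (\<lambda>(i, j). (\<lambda>i j.
          (if i = j then real (card {a \<in> S. (a, i) \<in> E}) + of_bool (i \<in> attach_verts G r k t') else 0)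
          - of_bool ((j, i) \<in> E)) (u i) (u j))"
proof -
  define m where "m = length vs - 1"
  have len: "length vs = Suc m" using p by (simp add: m_def)
  let ?u = "\<lambda>i. vs ! insert_index p i"
  have img: "insert_index p ` {..<m} = {..<Suc m} - {p}"
    using insert_index_image[of p m] p len by (simp add: atLeast0LessThan)
  have lt: "insert_index p i < length vs" if "i < m" for i
    using that len by (simp add: insert_index_def)
  have inj: "inj_on ?u {..<m}"
    using lt insert_index_inj_on[of p "{..<m}"] vs(1)
    by (auto simp: inj_on_def nth_eq_iff_index_eq)
  have "?u ` {..<m} = (!) vs ` ({..<Suc m} - {p})" unfolding img[symmetric] by (simp add: image_image)
  \<comment> \<open>Since \<open>vs\<close> is distinct, dropping position \<open>p\<close> removes
    exactly the vertex \<open>None\<close>.\<close>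
  also have "\<dots> = set vs - {None}"
  proof -
    have "inj_on ((!) vs) {..<Suc m}" using vs(1) len by (simp add: inj_on_nth)
    then have "(!) vs ` ({..<Suc m} - {p}) = (!) vs ` {..<Suc m} - (!) vs ` {p}"
      using p len by (intro inj_on_image_set_diff) auto
    also have "(!) vs ` {..<Suc m} = set vs"
      using len by (auto simp: set_conv_nth image_iff)
    finally show ?thesis using p by simp
  qed
  also have "\<dots> = Some ` S" using vs(2) by (auto simp: contracted_digraph_def S_def)
  finally have bij: "bij_betw ?u {..<m} (Some ` S)" using inj by (simp add: bij_betw_def)
  then have ubij: "bij_betw (the \<circ> ?u) {..<m} S"
    by (rule bij_betw_trans) (auto simp: bij_betw_def inj_on_def image_image)
  have us: "?u i = Some ((the \<circ> ?u) i)" if "i < m" for i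
  proof -
    have "?u i \<in> Some ` S" using bij_betwE[OF bij] that by blast
    then show ?thesis by auto
  qed
  \<comment> \<open>The diagonal test compares positions in the original matrix but vertices in the
    target; injectivity of both maps makes the tests agree.\<close>
  have eq: "insert_index p i = insert_index p j \<longleftrightarrow> (the \<circ> ?u) i = (the \<circ> ?u) j"
    if "i < m" "j < m" for i j
    using that inj_on_eq_iff[OF bij_betw_imp_inj_on[OF ubij]]
      inj_on_eq_iff[OF insert_index_inj_on[of p "{..<m}"]] by simp
  have "mat_delete (in_degree_matrix (contracted_digraph G r k t') vs) p p
      = mat m m (\<lambda>(i, j). (\<lambda>i j.
          (if i = j then real (card {a \<in> S. (a, i) \<in> E}) + of_bool (i \<in> attach_verts G r k t') else 0)
          - of_bool ((j, i) \<in> E)) ((the \<circ> ?u) i) ((the \<circ> ?u) j))" (is "_ = ?M")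
  proof (rule eq_matI)
    fix i j assume "i < dim_row ?M" "j < dim_col ?M"
    then have ij: "i < m" "j < m" by auto
    have "mat_delete (in_degree_matrix (contracted_digraph G r k t') vs) p p $$ (i, j)
        = in_degree_matrix (contracted_digraph G r k t') vs $$ (insert_index p i, insert_index p j)"
      using ij len
      by (simp add: mat_delete_def in_degree_matrix_def in_degree_diagonal_def insert_index_def)
    also have "\<dots> = (if insert_index p i = insert_index p j
          then real (in_degree (with_proj (contracted_digraph G r k t')) (?u i)) else 0)
        - of_bool ((?u j, ?u i) \<in> parcs (contracted_digraph G r k t'))"
      using lt ij by (simp add: in_degree_matrix_def in_degree_diagonal_def adjacency_matrix_def)
    also have "\<dots> = ?M $$ (i, j)"
      unfolding eq[OF ij] us[OF ij(1)] us[OF ij(2)] parcs_contracted_digraph_iff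
        in_degree_contracted_digraph[OF G]
      using ij by (simp add: E_def S_def)
    finally show "mat_delete (in_degree_matrix (contracted_digraph G r k t') vs) p p $$ (i, j)
      = ?M $$ (i, j)" .
  qed (simp_all add: in_degree_matrix_def in_degree_diagonal_def len)
  with ubij show thesis using that unfolding m_def by blast
qed

theorem mainTheorem4:
  fixes G :: "'a pair_pre_digraph" and w :: "('a \<times> 'a) weight_fun" and ix :: "'a \<Rightarrow> int"
    and r :: 'a and k :: nat and t' :: "'a pair_pre_digraph"
    and vs :: "'a option list" and p :: nat
  assumes "indexed_weighted_digraph G w ix"
    and "r \<in> pverts G"
    and "subgraph t' G" and "rooted_tree r t'" and "projective ix t'"
    and "tree_length r t' = ereal (real (k + 1))"
    and "distinct vs" and "set vs = pverts (contracted_digraph G r k t')"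
    and "p < length vs" and "vs ! p = None"
  shows "t' \<in> pre_spanning_trees G ix r (k + 1) \<longleftrightarrow>
    det (mat_delete (in_degree_matrix (contracted_digraph G r k t') vs) p p) \<noteq> 0"
proof -
  have G: "pair_fin_digraph G"
    using assms(1) by (simp add: indexed_weighted_digraph_def pair_digraph_def)
  let ?S = "pverts (delete_verts_of G t')" and ?E = "parcs (delete_verts_of G t')"
    and ?Z = "attach_verts G r k t'"
  have fin: "finite ?S" and E: "?E \<subseteq> ?S \<times> ?S" and Z: "?Z \<subseteq> ?S"
    using G by (auto simp: pair_fin_digraph_iff delete_verts_of_def attach_verts_def)
  obtain u where u: "bij_betw u {..<length vs - 1} ?S"
    and M: "mat_delete (in_degree_matrix (contracted_digraph G r k t') vs) p p
      = mat (length vs - 1) (length vs - 1) (\<lambda>(i, j). (\<lambda>i j.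
          (if i = j then real (card {a \<in> ?S. (a, i) \<in> ?E}) + of_bool (i \<in> ?Z) else 0)
          - of_bool ((j, i) \<in> ?E)) (u i) (u j))"
    using mat_delete_in_degree_matrix[OF G assms(7-10)] by blast
  show ?thesis
    \<comment> \<open>Both sides reduce to the same inclusion: every vertex of \<open>?S\<close> is
      reachable from \<open>?Z\<close> along \<open>?E\<close>.\<close>
    unfolding M pre_spanning_iff_reachable[OF G assms(3-6)]
    using det_reduced_in_degree_nonzero_iff[OF u fin E Z] by simp
qed

end
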